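(* Let $n\in\mathbb N$ and let $A$ be a real $n\times n$ matrix that is diagonalizable over $\mathbb R$ with positive eigenvalues. Let $H:\mathbb R^n\to\mathbb R$ be continuous, positively homogeneous of degree $\alpha>0$, with $H(x)>0$ for all $x\ne 0$, and suppose the map $x\in\mathbb R^n\mapsto H(x)Ax$ is locally Lipschitz. Let $t_*\ge 0$ and let $G:[t_*,\infty)\times\mathbb R^n\to\mathbb R^n$, $(t,x)\mapsto G(t,x)$, be continuous, and Lipschitz with respect to $x$ on any compact subset of $[t_*,\infty)\times\mathbb R^n$. Suppose there exist $c_*,r_*,\delta>0$ such that $|G(t,x)|\le c_*|x|^{1+\alpha+\delta}$ for all $t\ge t_*$ and all $x\in\mathbb R^n$ with $|x|\le r_*$. Then there is $r_0>0$ such that, for every $y_0\in\mathbb R^n$ with $0<|y_0|<r_0$, there exists a unique solution $y\in C^1([t_*,\infty),\mathbb R^n)$ of $$y'=-H(y)Ay+G(t,y)\quad\text{on }(t_*,\infty),\qquad y(t_* )=y_0.$$ Moreover, for each such solution there are two positive constants $C_1$ and $C_2$ such that $$C_1(1+t)^{-1/\alpha}\le |y(t)|\le C_2(1+t)^{-1/\alpha}\quad\text{for all }t\ge t_*.$$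
   Context: $|\cdot|$ is the Euclidean norm on $\mathbb R^n$. A function $F:\mathbb R^n\to\mathbb R$ is positively homogeneous of degree $\beta>0$ if $F(tx)=t^\beta F(x)$ for all $x\in\mathbb R^n$ and $t>0$. *)

theory Defs
  imports "HOL-Analysis.Analysis"
begin

definition diagonalizable :: "real^'n^'n \<Rightarrow> bool"
  where "diagonalizable A \<longleftrightarrow>
    (\<exists>P D :: real^'n^'n. invertible P \<and> (\<forall>i j. i \<noteq> j \<longrightarrow> D $ i $ j = 0) \<and>
       A = P ** D ** matrix_inv P)"

text \<open>Only real eigenvalues are considered; for a matrix diagonalizable over the reals there are
  no others.\<close>

definition eigenvalue :: "real^'n^'n \<Rightarrow> real \<Rightarrow> bool"
  where "eigenvalue A \<mu> \<longleftrightarrow> (\<exists>v. v \<noteq> 0 \<and> A *v v = \<mu> *\<^sub>R v)"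

definition pos_homogeneous :: "real \<Rightarrow> ('a::real_vector \<Rightarrow> real) \<Rightarrow> bool"
  where "pos_homogeneous \<beta> F \<longleftrightarrow> (\<forall>x. \<forall>t>0. F (t *\<^sub>R x) = t powr \<beta> * F x)"

definition locally_lipschitz :: "('a::metric_space \<Rightarrow> 'b::metric_space) \<Rightarrow> bool"
  where "locally_lipschitz f \<longleftrightarrow> (\<forall>x. \<exists>u>0. \<exists>L. L-lipschitz_on (cball x u) f)"

text \<open>Lipschitz continuity in the second argument, uniformly in the first, on every compact
  subset of \<open>T \<times> \<real>\<^sup>n\<close>.\<close>

definition lipschitz_snd_on_compacts ::
    "real set \<Rightarrow> (real \<Rightarrow> 'a::metric_space \<Rightarrow> 'b::metric_space) \<Rightarrow> bool"
  where "lipschitz_snd_on_compacts T G \<longleftrightarrow>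
    (\<forall>K. compact K \<and> K \<subseteq> T \<times> UNIV \<longrightarrow>
       (\<exists>L. \<forall>t. L-lipschitz_on {x. (t, x) \<in> K} (G t)))"

text \<open>The library's \<open>C1_differentiable_on\<close> takes two-sided derivatives at every point and hence
  depends on values outside \<open>S\<close>; here the derivative is taken within \<open>S\<close>, i.e. one-sided at
  the endpoint of a half-line.\<close>

definition C1_within :: "real set \<Rightarrow> (real \<Rightarrow> 'a::real_normed_vector) \<Rightarrow> bool"
  where "C1_within S y \<longleftrightarrow>
    (\<exists>y'. (\<forall>t\<in>S. (y has_vector_derivative y' t) (at t within S)) \<and> continuous_on S y')"

text \<open>Solutions are total functions of which only the values on \<open>[t\<^sub>0, \<infinity>)\<close> are relevant.\<close>

definition ode_solution ::
    "(real \<Rightarrow> 'a::real_normed_vector \<Rightarrow> 'a) \<Rightarrow> real \<Rightarrow> 'a \<Rightarrow> (real \<Rightarrow> 'a) \<Rightarrow> bool"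
  where "ode_solution f t\<^sub>0 y\<^sub>0 y \<longleftrightarrow>
    C1_within {t\<^sub>0..} y \<and> y t\<^sub>0 = y\<^sub>0 \<and>
    (\<forall>t>t\<^sub>0. (y has_vector_derivative f t (y t)) (at t))"

end

theory Submission
  imports Defs
begin

text \<open>In the coordinates \<open>w = P\<^sup>-\<^sup>1 y\<close> in which \<open>A\<close> is diagonal, \<open>V = (norm w)\<^sup>2\<close> satisfies
  \<open>- b V powr (1 + \<alpha>/2) \<le> V' \<le> - a V powr (1 + \<alpha>/2)\<close> along solutions near the origin: by
  homogeneity \<open>H y\<close> is comparable to \<open>V powr (\<alpha>/2)\<close>, and \<open>G\<close> is of higher order. Hence
  \<open>V powr (- \<alpha>/2)\<close> has derivative between two positive constants, so it grows linearly while
  \<open>V\<close> stays positive and never leaves the neighbourhood. Existence and uniqueness therefore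
  reduce to the field truncated outside a ball, which is globally Lipschitz in \<open>x\<close> on bounded
  time intervals.\<close>

section \<open>Existence by Picard iteration\<close>

primrec picard :: "(real \<Rightarrow> 'a::euclidean_space \<Rightarrow> 'a) \<Rightarrow> real \<Rightarrow> 'a \<Rightarrow> nat \<Rightarrow> real \<Rightarrow> 'a"
  where
    "picard f t\<^sub>0 y\<^sub>0 0 = (\<lambda>t. y\<^sub>0)"
  | "picard f t\<^sub>0 y\<^sub>0 (Suc k) = (\<lambda>t. y\<^sub>0 + integral {t\<^sub>0..t} (\<lambda>s. f s (picard f t\<^sub>0 y\<^sub>0 k s)))"

lemma continuous_on_nemytskii:
  fixes f :: "real \<Rightarrow> 'a::topological_space \<Rightarrow> 'b::topological_space"
  assumes "continuous_on (S \<times> UNIV) (\<lambda>(t, x). f t x)" and "continuous_on S y"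
  shows "continuous_on S (\<lambda>t. f t (y t))"
proof -
  have "continuous_on S (\<lambda>t. (\<lambda>(t, x). f t x) (t, y t))"
    by (rule continuous_on_compose2[OF assms(1)]) (auto intro!: continuous_intros assms(2))
  then show ?thesis by simp
qed

text \<open>Continuity at a point \<open>x\<close> depends only on a neighbourhood of
  \<open>x\<close>, where the half-line coincides with the interval ending at \<open>x + 1\<close>.
  This passes from bounded intervals, where all estimates live, to the half-line.\<close>

lemma continuous_on_Ici:
  fixes y :: "real \<Rightarrow> 'a::topological_space"
  assumes "\<And>T. continuous_on {t\<^sub>0..T} y"
  shows "continuous_on {t\<^sub>0..} y"
proof -
  have "continuous (at x within {t\<^sub>0..}) y" if "x \<ge> t\<^sub>0" for x
  proof -
    have "at x within {t\<^sub>0..} = at x within {t\<^sub>0..x + 1}"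
      by (rule at_within_nhd[of _ "{..<x + 1}"]) auto
    moreover have "continuous (at x within {t\<^sub>0..x + 1}) y"
      using assms[of "x + 1"] that by (simp add: continuous_on_eq_continuous_within)
    ultimately show ?thesis by simp
  qed
  then show ?thesis by (simp add: continuous_on_eq_continuous_within)
qed

lemma continuous_on_picard:
  assumes "continuous_on ({t\<^sub>0..} \<times> UNIV) (\<lambda>(t, x). f t x)"
  shows "continuous_on {t\<^sub>0..} (picard f t\<^sub>0 y\<^sub>0 k)"
proof (induction k)
  case (Suc k)
  have "continuous_on {t\<^sub>0..T} (picard f t\<^sub>0 y\<^sub>0 (Suc k))" for T
  proof -
    have "continuous_on {t\<^sub>0..T} (\<lambda>s. f s (picard f t\<^sub>0 y\<^sub>0 k s))"
      by (rule continuous_on_subset[OF continuous_on_nemytskii[OF assms Suc]]) auto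
    then show ?thesis
      by (auto intro!: continuous_intros indefinite_integral_continuous_1 integrable_continuous_real)
  qed
  then show ?case by (rule continuous_on_Ici)
qed simp

text \<open>The weight \<open>exp (2 L (t - t\<^sub>0))\<close> makes the Picard operator a contraction of factor \<open>1/2\<close> on
  every bounded time interval, however long.\<close>

lemma norm_picard_diff_le:
  assumes cont: "continuous_on ({t\<^sub>0..} \<times> UNIV) (\<lambda>(t, x). f t x)"
    and lip: "\<And>t. t \<in> {t\<^sub>0..T} \<Longrightarrow> L-lipschitz_on UNIV (f t)" and "L > 0"
    and M: "\<And>t. t \<in> {t\<^sub>0..T} \<Longrightarrow> norm (picard f t\<^sub>0 y\<^sub>0 1 t - y\<^sub>0) \<le> M"
    and "t \<in> {t\<^sub>0..T}"
  shows "norm (picard f t\<^sub>0 y\<^sub>0 (Suc k) t - picard f t\<^sub>0 y\<^sub>0 k t)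
    \<le> M * (1 / 2) ^ k * exp (2 * L * (t - t\<^sub>0))"
  using \<open>t \<in> {t\<^sub>0..T}\<close>
proof (induction k arbitrary: t)
  case 0
  have "M \<ge> 0" using M[OF 0] norm_ge_zero order_trans by blast
  then have "M * 1 \<le> M * exp (2 * L * (t - t\<^sub>0))"
    using 0 \<open>L > 0\<close> by (intro mult_left_mono) auto
  then show ?case using M[OF 0] by simp
next
  case (Suc k)
  \<comment> \<open>\<open>h\<close> is the bound wanted for \<open>Suc k\<close>, and its
    derivative \<open>h'\<close> is \<open>L\<close> times the bound for \<open>k\<close>: the
    factor 2 in the exponent cancels one factor 1/2. Integrating the Lipschitz estimate therefore
    reproduces \<open>h\<close>.\<close>
  define h where "h = (\<lambda>s. M * (1 / 2) ^ Suc k * exp (2 * L * (s - t\<^sub>0)))"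
  define h' where "h' = (\<lambda>s. L * (M * (1 / 2) ^ k * exp (2 * L * (s - t\<^sub>0))))"
  let ?f = "\<lambda>k s. f s (picard f t\<^sub>0 y\<^sub>0 k s)"
  have "M \<ge> 0" using M[OF Suc.prems] norm_ge_zero order_trans by blast
  have int: "?f k integrable_on {t\<^sub>0..t}" for k
    by (intro integrable_continuous_real
        continuous_on_subset[OF continuous_on_nemytskii[OF cont continuous_on_picard[OF cont]]]) auto
  have h: "(h' has_integral (h t - h t\<^sub>0)) {t\<^sub>0..t}"
  proof (rule fundamental_theorem_of_calculus)
    show "(h has_vector_derivative h' x) (at x within {t\<^sub>0..t})" for x
      unfolding h_def h'_def has_real_derivative_iff_has_vector_derivative[symmetric]
      by (auto intro!: derivative_eq_intros)
  qed (use Suc.prems in auto)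
  have "norm (picard f t\<^sub>0 y\<^sub>0 (Suc (Suc k)) t - picard f t\<^sub>0 y\<^sub>0 (Suc k) t)
    = norm (integral {t\<^sub>0..t} (?f (Suc k)) - integral {t\<^sub>0..t} (?f k))"
    by simp
  also have "\<dots> = norm (integral {t\<^sub>0..t} (\<lambda>s. ?f (Suc k) s - ?f k s))"
    by (subst integral_diff[OF int int]) simp
  also have "\<dots> \<le> integral {t\<^sub>0..t} h'"
  proof (rule integral_norm_bound_integral)
    fix s assume s: "s \<in> {t\<^sub>0..t}"
    then have "norm (?f (Suc k) s - ?f k s)
      \<le> L * norm (picard f t\<^sub>0 y\<^sub>0 (Suc k) s - picard f t\<^sub>0 y\<^sub>0 k s)"
      using lipschitz_onD[OF lip[of s]] Suc.prems by (simp only: dist_norm) auto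
    also have "\<dots> \<le> h' s"
      unfolding h'_def using Suc.IH[of s] s Suc.prems \<open>L > 0\<close> by (intro mult_left_mono) auto
    finally show "norm (?f (Suc k) s - ?f k s) \<le> h' s" .
  qed (use h int in \<open>auto intro!: integrable_diff simp del: picard.simps\<close>)
  also have "\<dots> = h t - h t\<^sub>0" using h by (rule integral_unique)
  also have "\<dots> \<le> h t" unfolding h_def using \<open>M \<ge> 0\<close> by simp
  finally show ?case by (simp add: h_def)
qed

text \<open>The limit is named by a pointwise \<open>lim\<close> that does not mention
  \<open>T\<close>, so that the convergence on all bounded intervals is towards one and the same
  function.\<close>

lemma uniform_limit_picard:
  assumes cont: "continuous_on ({t\<^sub>0..} \<times> UNIV) (\<lambda>(t, x). f t x)"
    and lip: "\<And>t. t \<in> {t\<^sub>0..T} \<Longrightarrow> L-lipschitz_on UNIV (f t)" and "L > 0"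
  shows "uniform_limit {t\<^sub>0..T} (picard f t\<^sub>0 y\<^sub>0) (\<lambda>t. lim (\<lambda>k. picard f t\<^sub>0 y\<^sub>0 k t)) sequentially"
proof -
  let ?p = "picard f t\<^sub>0 y\<^sub>0"
  have "bounded ((\<lambda>t. ?p 1 t - y\<^sub>0) ` {t\<^sub>0..T})"
    by (intro compact_imp_bounded compact_continuous_image continuous_intros
        continuous_on_subset[OF continuous_on_picard[OF cont]]) auto
  then obtain M where M: "\<And>t. t \<in> {t\<^sub>0..T} \<Longrightarrow> norm (?p 1 t - y\<^sub>0) \<le> M"
    unfolding bounded_iff by blast
  \<comment> \<open>The iterates are \<open>y\<^sub>0\<close> plus the partial sums of their
    increments. Replacing the exponential weight by its value at \<open>T\<close> gives a geometric
    majorant, uniform in \<open>t\<close>.\<close>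
  have "uniformly_convergent_on {t\<^sub>0..T} (\<lambda>n t. \<Sum>k<n. ?p (Suc k) t - ?p k t)"
  proof (rule Weierstrass_m_test'_ev[where M = "\<lambda>k. M * exp (2 * L * (T - t\<^sub>0)) * (1 / 2) ^ k"])
    show "\<forall>\<^sub>F k in sequentially. \<forall>t\<in>{t\<^sub>0..T}.
        norm (?p (Suc k) t - ?p k t) \<le> M * exp (2 * L * (T - t\<^sub>0)) * (1 / 2) ^ k"
    proof (intro always_eventually allI ballI)
      fix k t assume t: "t \<in> {t\<^sub>0..T}"
      have "M \<ge> 0" using M[OF t] norm_ge_zero order_trans by blast
      have "norm (?p (Suc k) t - ?p k t) \<le> M * (1 / 2) ^ k * exp (2 * L * (t - t\<^sub>0))"
        by (rule norm_picard_diff_le[OF cont lip \<open>L > 0\<close> M t])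
      also have "\<dots> \<le> M * (1 / 2) ^ k * exp (2 * L * (T - t\<^sub>0))"
        using \<open>M \<ge> 0\<close> \<open>L > 0\<close> t by (intro mult_left_mono) auto
      finally show "norm (?p (Suc k) t - ?p k t) \<le> M * exp (2 * L * (T - t\<^sub>0)) * (1 / 2) ^ k"
        by (simp add: mult_ac)
    qed
  qed (auto intro!: summable_mult summable_geometric)
  moreover have "(\<Sum>k<n. ?p (Suc k) t - ?p k t) = ?p n t - y\<^sub>0" for n t
    using sum_lessThan_telescope[of "\<lambda>k. ?p k t" n] by (simp del: picard.simps(2))
  ultimately have "uniformly_convergent_on {t\<^sub>0..T} (\<lambda>n t. ?p n t - y\<^sub>0)"
    by (simp only:)
  then obtain l where "uniform_limit {t\<^sub>0..T} (\<lambda>n t. ?p n t - y\<^sub>0) l sequentially"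
    unfolding uniformly_convergent_on_def by blast
  from uniform_limit_add[OF uniform_limit_const[of "\<lambda>t. y\<^sub>0"] this]
  have "uniformly_convergent_on {t\<^sub>0..T} ?p"
    unfolding uniformly_convergent_on_def by auto
  then show ?thesis by (simp add: uniformly_convergent_uniform_limit_iff)
qed

text \<open>On each bounded interval the iterates converge uniformly, so the limit passes through
  the integral in the recursion and satisfies the integral equation; differentiating it gives the
  solution. The Lipschitz constant may grow with \<open>T\<close>, as every argument takes place on
  a bounded interval.\<close>

lemma ode_solution_exists:
  fixes f :: "real \<Rightarrow> 'a::euclidean_space \<Rightarrow> 'a"
  assumes cont: "continuous_on ({t\<^sub>0..} \<times> UNIV) (\<lambda>(t, x). f t x)"
    and lip: "\<And>T. \<exists>L. \<forall>t\<in>{t\<^sub>0..T}. L-lipschitz_on UNIV (f t)"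
  shows "\<exists>y. ode_solution f t\<^sub>0 y\<^sub>0 y"
proof -
  let ?p = "picard f t\<^sub>0 y\<^sub>0"
  define y where "y = (\<lambda>t. lim (\<lambda>k. ?p k t))"
  \<comment> \<open>The constant is enlarged to be positive: the convergence lemma requires this,
    and \<open>e / L\<close> occurs below.\<close>
  have lip': "\<exists>L>0. \<forall>t\<in>{t\<^sub>0..T}. L-lipschitz_on UNIV (f t)" for T
  proof -
    obtain L where "\<forall>t\<in>{t\<^sub>0..T}. L-lipschitz_on UNIV (f t)" using lip by blast
    then have "\<forall>t\<in>{t\<^sub>0..T}. (max L 1)-lipschitz_on UNIV (f t)"
      by (meson lipschitz_on_le max.cobounded1)
    then show ?thesis by (intro exI[of _ "max L 1"]) auto
  qed
  have lim: "uniform_limit {t\<^sub>0..T} ?p y sequentially" for T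
    using lip'[of T] uniform_limit_picard[OF cont] unfolding y_def by blast
  have cont_y: "continuous_on {t\<^sub>0..} y"
  proof (rule continuous_on_Ici)
    show "continuous_on {t\<^sub>0..T} y" for T
      by (rule uniform_limit_theorem[OF _ lim])
        (auto intro!: always_eventually continuous_on_subset[OF continuous_on_picard[OF cont]])
  qed
  have cont_fy: "continuous_on {t\<^sub>0..} (\<lambda>t. f t (y t))"
    by (rule continuous_on_nemytskii[OF cont cont_y])
  have integral_eq: "y t = y\<^sub>0 + integral {t\<^sub>0..t} (\<lambda>s. f s (y s))" if "t \<ge> t\<^sub>0" for t
  proof -
    obtain L where L: "L > 0" "\<And>s. s \<in> {t\<^sub>0..t} \<Longrightarrow> L-lipschitz_on UNIV (f s)"
      using lip' by blast
    have ul: "uniform_limit {t\<^sub>0..t} (\<lambda>k s. f s (?p k s)) (\<lambda>s. f s (y s)) sequentially"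
    proof (rule uniform_limitI)
      fix e :: real assume "e > 0"
      then have "\<forall>\<^sub>F k in sequentially. \<forall>s\<in>{t\<^sub>0..t}. dist (?p k s) (y s) < e / L"
        using L by (intro uniform_limitD[OF lim]) auto
      then show "\<forall>\<^sub>F k in sequentially. \<forall>s\<in>{t\<^sub>0..t}. dist (f s (?p k s)) (f s (y s)) < e"
      proof (rule eventually_mono, intro ballI)
        fix k s assume *: "\<forall>s\<in>{t\<^sub>0..t}. dist (?p k s) (y s) < e / L" and s: "s \<in> {t\<^sub>0..t}"
        have "dist (f s (?p k s)) (f s (y s)) \<le> L * dist (?p k s) (y s)"
          using lipschitz_onD[OF L(2)[OF s]] by blast
        also have "\<dots> < e" using * s L(1) by (auto simp: field_simps)
        finally show "dist (f s (?p k s)) (f s (y s)) < e" .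
      qed
    qed
    have "continuous_on {t\<^sub>0..t} (\<lambda>s. f s (?p k s))" for k
      by (rule continuous_on_subset[OF continuous_on_nemytskii[OF cont continuous_on_picard[OF cont]]])
        auto
    from uniform_limit_integral[OF ul this] obtain I J where
      I: "\<And>k. ((\<lambda>s. f s (?p k s)) has_integral I k) {t\<^sub>0..t}" and
      J: "((\<lambda>s. f s (y s)) has_integral J) {t\<^sub>0..t}" and "I \<longlonglongrightarrow> J"
      by (metis sequentially_bot)
    then have "(\<lambda>k. ?p (Suc k) t) \<longlonglongrightarrow> y\<^sub>0 + J"
      using integral_unique[OF I] by (auto intro!: tendsto_intros)
    moreover have "(\<lambda>k. ?p (Suc k) t) \<longlonglongrightarrow> y t"
      using tendsto_uniform_limitI[OF lim[of t], of t] that by (intro LIMSEQ_Suc) auto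
    ultimately have "y t = y\<^sub>0 + J" by (metis LIMSEQ_unique)
    then show ?thesis using integral_unique[OF J] by simp
  qed
  \<comment> \<open>Derivatives within the half-line include the one-sided one at
    \<open>t\<^sub>0\<close> that \<open>C1_within\<close> asks for; at interior points they are
    two-sided.\<close>
  have deriv: "(y has_vector_derivative f t (y t)) (at t within {t\<^sub>0..})" if t: "t \<in> {t\<^sub>0..}" for t
  proof -
    have eq: "at t within {t\<^sub>0..} = at t within {t\<^sub>0..t + 1}"
      by (rule at_within_nhd[of _ "{..<t + 1}"]) auto
    have "((\<lambda>u. integral {t\<^sub>0..u} (\<lambda>s. f s (y s))) has_vector_derivative f t (y t))
        (at t within {t\<^sub>0..t + 1})"
      using t by (intro integral_has_vector_derivative continuous_on_subset[OF cont_fy]) auto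
    then have "((\<lambda>u. y\<^sub>0 + integral {t\<^sub>0..u} (\<lambda>s. f s (y s))) has_vector_derivative f t (y t))
        (at t within {t\<^sub>0..})"
      unfolding eq by (auto intro!: derivative_eq_intros)
    then show ?thesis
      by (rule has_vector_derivative_transform[OF t integral_eq, rotated]) auto
  qed
  have "(y has_vector_derivative f t (y t)) (at t)" if "t > t\<^sub>0" for t
    using deriv[of t] at_within_interior[of t "{t\<^sub>0..}"] that by (simp add: interior_real_atLeast)
  then have "ode_solution f t\<^sub>0 y\<^sub>0 y"
    unfolding ode_solution_def C1_within_def
    using deriv cont_fy integral_eq[of t\<^sub>0] by (auto intro!: exI[of _ "\<lambda>t. f t (y t)"])
  then show ?thesis by blast
qed

section \<open>Uniqueness by a weighted energy estimate\<close>

lemma ode_solution_continuous_on: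
  assumes "ode_solution f t\<^sub>0 y\<^sub>0 y"
  shows "continuous_on {t\<^sub>0..} y"
  using assms unfolding ode_solution_def C1_within_def
  by (meson continuous_on_eq_continuous_within has_vector_derivative_continuous)

text \<open>Serves twice: for the squared distance of two solutions, and for the Lyapunov function
  along a solution.\<close>

lemma has_real_derivative_inner_self:
  assumes "(u has_vector_derivative u') (at s)"
  shows "((\<lambda>s. u s \<bullet> u s) has_real_derivative 2 * (u s \<bullet> u')) (at s)"
  using has_derivative_inner[OF assms[unfolded has_vector_derivative_def]
      assms[unfolded has_vector_derivative_def]]
  by (auto simp: has_field_derivative_def inner_commute algebra_simps
      elim!: has_derivative_eq_rhs intro!: ext)

text \<open>A Gronwall argument: by Cauchy-Schwarz the squared distance of two solutions grows at
  most at rate \<open>2 * L\<close>, so after multiplication by \<open>exp (- (2 * L * s))\<close>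
  it is nonincreasing, and it starts at 0.\<close>

lemma ode_solution_unique:
  fixes f :: "real \<Rightarrow> 'a::real_inner \<Rightarrow> 'a"
  assumes lip: "\<And>T. \<exists>L. \<forall>t\<in>{t\<^sub>0..T}. L-lipschitz_on UNIV (f t)"
    and y: "ode_solution f t\<^sub>0 y\<^sub>0 y" and z: "ode_solution f t\<^sub>0 y\<^sub>0 z" and "t \<ge> t\<^sub>0"
  shows "z t = y t"
proof -
  obtain L where L: "\<And>s. s \<in> {t\<^sub>0..t} \<Longrightarrow> L-lipschitz_on UNIV (f s)"
    using lip by blast
  define u where "u = (\<lambda>s. y s - z s)"
  define u' where "u' = (\<lambda>s. f s (y s) - f s (z s))"
  define \<phi> where "\<phi> = (\<lambda>s. exp (- (2 * L * s)) * (u s \<bullet> u s))"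
  have "\<phi> t \<le> \<phi> t\<^sub>0"
  \<comment> \<open>Two-sided derivatives are available only after \<open>t\<^sub>0\<close>; at the
    endpoint continuity takes their place.\<close>
  proof (rule DERIV_nonpos_imp_decreasing_open[OF \<open>t \<ge> t\<^sub>0\<close>])
    fix s assume s: "t\<^sub>0 < s" "s < t"
    let ?e = "exp (- (2 * L * s))"
    have "(u has_vector_derivative u' s) (at s)"
      unfolding u_def u'_def using y z s
      by (auto simp: ode_solution_def intro!: derivative_eq_intros)
    from has_real_derivative_inner_self[OF this]
    have "(\<phi> has_real_derivative ?e * (2 * (u s \<bullet> u' s)) - 2 * L * ?e * (u s \<bullet> u s)) (at s)"
      unfolding \<phi>_def by (auto intro!: derivative_eq_intros)
    moreover have "u s \<bullet> u' s \<le> L * (u s \<bullet> u s)"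
    proof -
      have "u s \<bullet> u' s \<le> norm (u s) * norm (u' s)" by (rule norm_cauchy_schwarz)
      also have "\<dots> \<le> norm (u s) * (L * norm (u s))"
        using lipschitz_onD[OF L[of s], of "y s" "z s"] s
        by (intro mult_left_mono) (auto simp: u_def u'_def dist_norm)
      finally show ?thesis by (simp add: dot_square_norm power2_eq_square mult_ac)
    qed
    then have "?e * (u s \<bullet> u' s) \<le> ?e * (L * (u s \<bullet> u s))"
      by (intro mult_left_mono) auto
    then have "?e * (2 * (u s \<bullet> u' s)) - 2 * L * ?e * (u s \<bullet> u s) \<le> 0"
      by (simp add: algebra_simps)
    ultimately show "\<exists>d. (\<phi> has_real_derivative d) (at s) \<and> d \<le> 0"
      by blast
  next
    show "continuous_on {t\<^sub>0..t} \<phi>"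
      unfolding \<phi>_def u_def
      by (intro continuous_intros continuous_on_subset[OF ode_solution_continuous_on[OF y]]
          continuous_on_subset[OF ode_solution_continuous_on[OF z]]) auto
  qed
  also have "\<phi> t\<^sub>0 = 0" using y z by (simp add: \<phi>_def u_def ode_solution_def)
  finally have "u t \<bullet> u t \<le> 0" by (simp add: \<phi>_def mult_le_0_iff)
  then have "u t = 0" by (metis inner_eq_zero_iff inner_ge_zero order_antisym)
  then show ?thesis by (simp add: u_def)
qed

section \<open>A scalar differential inequality with power nonlinearity\<close>

text \<open>The substitution \<open>U = V powr (- \<beta>)\<close> linearizes the inequality: the
  slope of \<open>U\<close> lies between \<open>a * \<beta>\<close> and \<open>b * \<beta>\<close>.
  The bounds on the derivative are available only while \<open>V\<close> is in the strip between 0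
  and \<open>E\<close>, so staying there has to be proved first, by a first-exit argument.\<close>

lemma powr_decay:
  fixes V :: "real \<Rightarrow> real"
  assumes cont: "continuous_on {t\<^sub>0..} V" and V0: "0 < V t\<^sub>0" "V t\<^sub>0 < E"
    and "t\<^sub>0 \<ge> 0" "\<beta> > 0" "a > 0"
    and deriv: "\<And>t. t > t\<^sub>0 \<Longrightarrow> 0 < V t \<Longrightarrow> V t < E \<Longrightarrow>
      \<exists>d. (V has_real_derivative d) (at t) \<and>
        - b * V t powr (1 + \<beta>) \<le> d \<and> d \<le> - a * V t powr (1 + \<beta>)"
  shows "\<forall>t\<ge>t\<^sub>0. 0 < V t \<and> V t < E"
    and "\<exists>k>0. \<exists>K>0. \<forall>t\<ge>t\<^sub>0. k * (1 + t) \<le> V t powr (- \<beta>) \<and> V t powr (- \<beta>) \<le> K * (1 + t)"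
proof -
  define U where "U = (\<lambda>t. V t powr (- \<beta>))"
  \<comment> \<open>Conditional on \<open>V\<close> having stayed in the strip up to time
    \<open>t\<close>; applied first before a hypothetical exit time and, once exit is excluded, to
    all \<open>t\<close>.\<close>
  have U_bounds: "U t\<^sub>0 + a * \<beta> * (t - t\<^sub>0) \<le> U t" "U t \<le> U t\<^sub>0 + b * \<beta> * (t - t\<^sub>0)"
    if "t \<ge> t\<^sub>0" and region: "\<And>s. s \<in> {t\<^sub>0..t} \<Longrightarrow> 0 < V s \<and> V s < E" for t
  proof -
    have contU: "continuous_on {t\<^sub>0..t} U"
      unfolding U_def
      by (intro continuous_intros continuous_on_subset[OF cont]) (use region in force)+
    have dU: "\<exists>d. (U has_real_derivative d) (at s) \<and> a * \<beta> \<le> d \<and> d \<le> b * \<beta>"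
      if s: "t\<^sub>0 < s" "s < t" for s
    proof -
      have Vs: "0 < V s" "V s < E" using region[of s] s by auto
      obtain d where d: "(V has_real_derivative d) (at s)"
        "- b * V s powr (1 + \<beta>) \<le> d" "d \<le> - a * V s powr (1 + \<beta>)"
        using deriv[OF s(1) Vs] by blast
      \<comment> \<open>Multiplying by \<open>?p\<close> turns the bounds on \<open>d\<close> into
        the constants \<open>- b\<close> and \<open>- a\<close>; the factor \<open>- \<beta>\<close>
        from the chain rule then exchanges upper and lower bound.\<close>
      let ?p = "V s powr (- (1 + \<beta>))"
      have p: "V s powr (1 + \<beta>) * ?p = 1" using Vs by (simp add: powr_add[symmetric])
      have "(U has_real_derivative (- \<beta> * (d * ?p))) (at s)"
        unfolding U_def using Vs d(1)
        by (auto intro!: derivative_eq_intros simp: minus_diff_commute)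
      moreover have "- b \<le> d * ?p"
        using mult_right_mono[OF d(2), of ?p] p by (simp add: mult.assoc)
      moreover have "d * ?p \<le> - a"
        using mult_right_mono[OF d(3), of ?p] p by (simp add: mult.assoc)
      ultimately show ?thesis
        using mult_left_mono[of "- b" "d * ?p" \<beta>] mult_left_mono[of "d * ?p" "- a" \<beta>] \<open>\<beta> > 0\<close>
        by (intro exI[of _ "- \<beta> * (d * ?p)"]) (auto simp: mult_ac)
    qed
    have "U t\<^sub>0 - a * \<beta> * t\<^sub>0 \<le> U t - a * \<beta> * t"
    proof (rule DERIV_nonneg_imp_increasing_open[OF \<open>t \<ge> t\<^sub>0\<close>])
      fix s assume "t\<^sub>0 < s" "s < t"
      then obtain d where "(U has_real_derivative d) (at s)" "a * \<beta> \<le> d" using dU by blast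
      then show "\<exists>d. ((\<lambda>s. U s - a * \<beta> * s) has_real_derivative d) (at s) \<and> 0 \<le> d"
        by (intro exI[of _ "d - a * \<beta>"]) (auto intro!: derivative_eq_intros)
    qed (intro continuous_intros contU)
    then show "U t\<^sub>0 + a * \<beta> * (t - t\<^sub>0) \<le> U t" by (simp add: algebra_simps)
    have "U t - b * \<beta> * t \<le> U t\<^sub>0 - b * \<beta> * t\<^sub>0"
    proof (rule DERIV_nonpos_imp_decreasing_open[OF \<open>t \<ge> t\<^sub>0\<close>])
      fix s assume "t\<^sub>0 < s" "s < t"
      then obtain d where "(U has_real_derivative d) (at s)" "d \<le> b * \<beta>" using dU by blast
      then show "\<exists>d. ((\<lambda>s. U s - b * \<beta> * s) has_real_derivative d) (at s) \<and> d \<le> 0"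
        by (intro exI[of _ "d - b * \<beta>"]) (auto intro!: derivative_eq_intros)
    qed (intro continuous_intros contU)
    then show "U t \<le> U t\<^sub>0 + b * \<beta> * (t - t\<^sub>0)" by (simp add: algebra_simps)
  qed
  show region: "\<forall>t\<ge>t\<^sub>0. 0 < V t \<and> V t < E"
  proof (rule ccontr)
    \<comment> \<open>The times outside the strip form a closed set, since \<open>V\<close> is
      continuous and the strip is open. Hence there is a first such time \<open>T\<close>, and it
      lies in \<open>S\<close> itself.\<close>
    define S where "S = {t\<in>{t\<^sub>0..}. V t \<in> {..0} \<union> {E..}}"
    assume "\<not> ?thesis"
    then have "S \<noteq> {}" by (auto simp: S_def not_less)
    moreover have "closed ({t\<^sub>0..} \<inter> V -` ({..0} \<union> {E..}))"
      by (intro continuous_closed_preimage cont closed_Un) auto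
    then have "closed S" by (simp add: S_def Int_def vimage_def)
    moreover have bdd: "bdd_below S" by (auto simp: S_def bdd_below_def)
    ultimately have inS: "Inf S \<in> S" by (intro closed_contains_Inf)
    define T where "T = Inf S"
    have T: "T \<in> S" using inS by (simp add: T_def)
    then have "T > t\<^sub>0" using V0 by (cases "T = t\<^sub>0") (auto simp: S_def)
    have reg: "0 < V s \<and> V s < E" if "s \<in> {t\<^sub>0..<T}" for s
    proof (rule ccontr)
      assume "\<not> ?thesis"
      then have "s \<in> S" using that by (auto simp: S_def)
      then have "T \<le> s" unfolding T_def by (rule cInf_lower[OF _ bdd])
      then show False using that by auto
    qed
    \<comment> \<open>Before \<open>T\<close>, \<open>U\<close> is at least
      \<open>U t\<^sub>0\<close> and at most the base of this power, so \<open>V\<close> stays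
      between \<open>m\<close> and \<open>V t\<^sub>0\<close>. This closed interval lies inside the
      strip and contains \<open>V T\<close> by continuity, a contradiction. The absolute value is
      there because no sign of \<open>b\<close> is assumed.\<close>
    define m where "m = (U t\<^sub>0 + \<bar>b * \<beta>\<bar> * (T - t\<^sub>0)) powr (- 1 / \<beta>)"
    have "U t\<^sub>0 > 0" using V0 by (simp add: U_def)
    have "m > 0"
      unfolding m_def using \<open>U t\<^sub>0 > 0\<close> \<open>T > t\<^sub>0\<close>
      by (metis add_pos_nonneg abs_ge_zero diff_ge_0_iff_ge less_imp_le mult_nonneg_nonneg
          powr_gt_zero less_irrefl)
    have bnd: "V s \<in> {m..V t\<^sub>0}" if s: "s \<in> {t\<^sub>0..<T}" for s
    proof -
      have Vs: "V s > 0" using reg[OF s] by simp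
      have V_eq: "U r powr (- 1 / \<beta>) = V r" if "V r > 0" for r
        using that \<open>\<beta> > 0\<close> by (simp add: U_def powr_powr)
      have le: "U t\<^sub>0 + a * \<beta> * (s - t\<^sub>0) \<le> U s" "U s \<le> U t\<^sub>0 + b * \<beta> * (s - t\<^sub>0)"
        using U_bounds[of s] reg s by auto
      have "U t\<^sub>0 \<le> U s" using le(1) s \<open>a > 0\<close> \<open>\<beta> > 0\<close>
        by (smt (verit) atLeastLessThan_iff mult_nonneg_nonneg)
      then have "U s powr (- 1 / \<beta>) \<le> U t\<^sub>0 powr (- 1 / \<beta>)"
        using \<open>U t\<^sub>0 > 0\<close> \<open>\<beta> > 0\<close> by (intro powr_mono2') auto
      moreover have "b * \<beta> * (s - t\<^sub>0) \<le> \<bar>b * \<beta>\<bar> * (T - t\<^sub>0)"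
        using s by (intro mult_mono) auto
      then have "m \<le> U s powr (- 1 / \<beta>)"
        unfolding m_def using le(2) Vs \<open>\<beta> > 0\<close> by (intro powr_mono2') (auto simp: U_def)
      ultimately show ?thesis using V_eq Vs V0 by simp
    qed
    have "V T \<in> {m..V t\<^sub>0}"
    proof -
      have "continuous_on {t\<^sub>0..T} V" by (rule continuous_on_subset[OF cont]) auto
      then have "(V \<longlongrightarrow> V T) (at_left T)"
        using \<open>T > t\<^sub>0\<close> by (simp add: continuous_on_Icc_at_leftD)
      moreover have "\<forall>\<^sub>F s in at_left T. V s \<in> {m..V t\<^sub>0}"
        using eventually_at_left_real[OF \<open>T > t\<^sub>0\<close>] by eventually_elim (rule bnd, simp)
      ultimately show ?thesis
        by (intro Lim_in_closed_set[where F = "at_left T" and f = V]) auto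
    qed
    then show False using T \<open>m > 0\<close> V0 by (auto simp: S_def)
  qed
  \<comment> \<open>The lines \<open>k * (1 + t)\<close> and \<open>K * (1 + t)\<close> must enclose
    \<open>U\<close> at the start, where it equals \<open>u * (1 + t\<^sub>0)\<close>, and must also
    have slopes that enclose those of \<open>U\<close>; hence the minimum and the maximum.\<close>
  define u where "u = U t\<^sub>0 / (1 + t\<^sub>0)"
  define k where "k = min u (a * \<beta>)"
  define K where "K = max u (b * \<beta>)"
  have "u > 0" using V0 \<open>t\<^sub>0 \<ge> 0\<close> by (auto simp: u_def U_def)
  have u: "U t\<^sub>0 = u * (1 + t\<^sub>0)" using \<open>t\<^sub>0 \<ge> 0\<close> by (auto simp: u_def)
  have "k * (1 + t) \<le> U t \<and> U t \<le> K * (1 + t)" if "t \<ge> t\<^sub>0" for t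
  proof -
    have "k * (1 + t\<^sub>0) + k * (t - t\<^sub>0) \<le> U t\<^sub>0 + a * \<beta> * (t - t\<^sub>0)"
      unfolding u using that \<open>t\<^sub>0 \<ge> 0\<close> by (intro add_mono mult_right_mono) (auto simp: k_def)
    moreover have "U t\<^sub>0 + b * \<beta> * (t - t\<^sub>0) \<le> K * (1 + t\<^sub>0) + K * (t - t\<^sub>0)"
      unfolding u using that \<open>t\<^sub>0 \<ge> 0\<close> by (intro add_mono mult_right_mono) (auto simp: K_def)
    ultimately show ?thesis
      using U_bounds[OF that] region by (auto simp: algebra_simps)
  qed
  moreover have "k > 0" "K > 0" using \<open>u > 0\<close> \<open>a > 0\<close> \<open>\<beta> > 0\<close> by (auto simp: k_def K_def)
  ultimately show "\<exists>k>0. \<exists>K>0. \<forall>t\<ge>t\<^sub>0. k * (1 + t) \<le> V t powr (- \<beta>) \<and> V t powr (- \<beta>) \<le> K * (1 + t)"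
    unfolding U_def by blast
qed

section \<open>Lyapunov estimates in diagonalizing coordinates\<close>

text \<open>The constants are the minimum and maximum of \<open>H\<close> on the unit sphere,
  positive by compactness; homogeneity carries the bounds along rays.\<close>

lemma pos_homogeneous_bounds:
  fixes H :: "'a::euclidean_space \<Rightarrow> real"
  assumes "continuous_on UNIV H" and "pos_homogeneous \<alpha> H" and "\<And>x. x \<noteq> 0 \<Longrightarrow> H x > 0"
  obtains h\<^sub>1 h\<^sub>2 where "h\<^sub>1 > 0" "h\<^sub>2 > 0"
    "\<And>x. x \<noteq> 0 \<Longrightarrow> h\<^sub>1 * norm x powr \<alpha> \<le> H x \<and> H x \<le> h\<^sub>2 * norm x powr \<alpha>"
proof -
  let ?S = "sphere (0::'a) 1"
  have cont: "continuous_on ?S H" using assms(1) continuous_on_subset by blast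
  have ne: "?S \<noteq> {}" by simp
  obtain u where u: "u \<in> ?S" "\<And>x. x \<in> ?S \<Longrightarrow> H u \<le> H x"
    using continuous_attains_inf[OF compact_sphere ne cont] by blast
  obtain v where v: "v \<in> ?S" "\<And>x. x \<in> ?S \<Longrightarrow> H x \<le> H v"
    using continuous_attains_sup[OF compact_sphere ne cont] by blast
  show ?thesis
  proof (rule that[of "H u" "H v"])
    show "H u > 0" "H v > 0" using u(1) v(1) by (auto intro!: assms(3))
    fix x :: 'a assume "x \<noteq> 0"
    then have "H (norm x *\<^sub>R (x /\<^sub>R norm x)) = norm x powr \<alpha> * H (x /\<^sub>R norm x)"
      using assms(2) unfolding pos_homogeneous_def by (metis zero_less_norm_iff)
    then have "H x = H (x /\<^sub>R norm x) * norm x powr \<alpha>" using \<open>x \<noteq> 0\<close> by simp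
    moreover have "x /\<^sub>R norm x \<in> ?S" using \<open>x \<noteq> 0\<close> by simp
    ultimately show "H u * norm x powr \<alpha> \<le> H x \<and> H x \<le> H v * norm x powr \<alpha>"
      using u(2) v(2) by (simp add: mult_right_mono)
  qed
qed

lemma diagonal_matrix_vector_mult:
  fixes D :: "real^'n^'n"
  assumes "\<And>i j. i \<noteq> j \<Longrightarrow> D $ i $ j = 0"
  shows "(D *v w) $ i = D $ i $ i * w $ i"
proof -
  have "(\<Sum>j\<in>UNIV. D $ i $ j * w $ j) = (\<Sum>j\<in>UNIV. if j = i then D $ i $ i * w $ i else 0)"
    by (rule sum.cong) (use assms in auto)
  then show ?thesis by (simp add: matrix_vector_mult_def)
qed

text \<open>The quadratic form is a sum of squares weighted by the diagonal entries, so the least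
  and the greatest entry serve as constants.\<close>

lemma diagonal_inner_bounds:
  fixes D :: "real^'n^'n"
  assumes diag: "\<And>i j. i \<noteq> j \<Longrightarrow> D $ i $ j = 0" and pos: "\<And>i. D $ i $ i > 0"
  obtains d\<^sub>1 d\<^sub>2 where "d\<^sub>1 > 0" "d\<^sub>2 > 0"
    "\<And>w. d\<^sub>1 * (norm w)\<^sup>2 \<le> w \<bullet> (D *v w) \<and> w \<bullet> (D *v w) \<le> d\<^sub>2 * (norm w)\<^sup>2"
proof -
  define R where "R = range (\<lambda>i. D $ i $ i)"
  have R: "finite R" "R \<noteq> {}" by (auto simp: R_def)
  have pos': "\<forall>d\<in>R. d > 0" using pos by (auto simp: R_def)
  show ?thesis
  proof (rule that[of "Min R" "Max R"])
    show "Min R > 0" "Max R > 0" using R pos' Min_in Max_in by blast+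
    fix w :: "real^'n"
    have eq: "w \<bullet> (D *v w) = (\<Sum>i\<in>UNIV. D $ i $ i * (w $ i)\<^sup>2)"
      by (simp add: inner_vec_def diagonal_matrix_vector_mult[OF diag] power2_eq_square mult_ac)
    have norm: "(norm w)\<^sup>2 = (\<Sum>i\<in>UNIV. (w $ i)\<^sup>2)"
      unfolding power2_norm_eq_inner inner_vec_def by (simp add: power2_eq_square)
    have "D $ i $ i \<in> R" for i by (simp add: R_def)
    then show "Min R * (norm w)\<^sup>2 \<le> w \<bullet> (D *v w) \<and> w \<bullet> (D *v w) \<le> Max R * (norm w)\<^sup>2"
      unfolding eq norm sum_distrib_left using R
      by (auto intro!: sum_mono mult_right_mono Min_le Max_ge)
  qed
qed

text \<open>The eigenvector is the image under \<open>P\<close> of a standard basis vector. This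
  turns positivity of the eigenvalues into positivity of the diagonal entries.\<close>

lemma eigenvalue_diagonal:
  fixes P Q D :: "real^'n^'n"
  assumes "Q ** P = mat 1" and diag: "\<And>i j. i \<noteq> j \<Longrightarrow> D $ i $ j = 0"
  shows "eigenvalue (P ** D ** Q) (D $ i $ i)"
proof -
  let ?e = "axis i 1 :: real^'n"
  have QP: "Q *v (P *v x) = x" for x using assms(1) by (simp add: matrix_vector_mul_assoc)
  have "D *v ?e = (D $ i $ i) *\<^sub>R ?e"
    by (simp add: vec_eq_iff diagonal_matrix_vector_mult[OF diag] axis_def)
  then have "(P ** D ** Q) *v (P *v ?e) = (D $ i $ i) *\<^sub>R (P *v ?e)"
    by (simp add: matrix_vector_mul_assoc[symmetric] QP matrix_vector_mult_scaleR)
  moreover have "P *v ?e \<noteq> 0"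
    using QP[of ?e] by (metis axis_eq_0_iff matrix_vector_mult_0_right zero_neq_one)
  ultimately show ?thesis unfolding eigenvalue_def by blast
qed

lemma matrix_vector_mult_norm_bound:
  fixes P :: "real^'n^'m"
  obtains p where "p > 0" "\<And>x. norm (P *v x) \<le> p * norm x"
  using bounded_linear.pos_bounded[OF matrix_vector_mul_bounded_linear[of P]]
  by (metis mult.commute)

lemma locally_lipschitz_imp_lipschitz_on_compact:
  fixes F :: "'a::metric_space \<Rightarrow> 'b::metric_space"
  assumes "locally_lipschitz F" and "compact X"
  obtains L where "L-lipschitz_on X F"
proof -
  \<comment> \<open>The library notion concerns families depending on a parameter; a constant family
    over a single parameter value expresses the present one.\<close>
  have "local_lipschitz {0::real} X (\<lambda>_. F)"
    using assms(1) unfolding locally_lipschitz_def local_lipschitz_def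
    by (meson inf_le1 lipschitz_on_subset)
  then obtain L where "\<And>t::real. t \<in> {0} \<Longrightarrow> L-lipschitz_on X F"
    using local_lipschitz_compact_implies_lipschitz[of "{0::real}" X "\<lambda>_. F"] assms(2)
    by (metis compact_sing continuous_on_const local_lipschitz_compact_implies_lipschitz)
  then show ?thesis using that by simp
qed

text \<open>A pointwise statement in \<open>t\<close> and \<open>x\<close>: no solution enters, so
  it can be used for any field that agrees with this one near the origin. \<open>Q\<close> is the
  inverse of the diagonalizing matrix, and \<open>p\<close>, \<open>q\<close> compare the norms of
  \<open>x\<close> and \<open>Q *v x\<close>.\<close>

lemma lyapunov_bounds:
  fixes A :: "real^'n^'n" and H :: "real^'n \<Rightarrow> real" and G :: "real \<Rightarrow> real^'n \<Rightarrow> real^'n"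
  assumes diag: "diagonalizable A"
    and eigen: "\<And>\<mu>. eigenvalue A \<mu> \<Longrightarrow> \<mu> > 0"
    and "\<alpha> > 0"
    and H: "continuous_on UNIV H" "pos_homogeneous \<alpha> H" "\<And>x. x \<noteq> 0 \<Longrightarrow> H x > 0"
    and "c > 0" "r > 0" "\<delta> > 0"
    and G: "\<And>t x. t \<ge> t\<^sub>0 \<Longrightarrow> norm x \<le> r \<Longrightarrow> norm (G t x) \<le> c * norm x powr (1 + \<alpha> + \<delta>)"
  obtains Q :: "real^'n^'n" and p q E a b
  where "p > 0" "q > 0" "E > 0" "a > 0"
    "\<And>x. norm x \<le> p * norm (Q *v x)" "\<And>x. norm (Q *v x) \<le> q * norm x"
    "\<And>x. (norm (Q *v x))\<^sup>2 < E \<Longrightarrow> norm x \<le> r"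
    "\<And>t x. t \<ge> t\<^sub>0 \<Longrightarrow> x \<noteq> 0 \<Longrightarrow> (norm (Q *v x))\<^sup>2 < E \<Longrightarrow>
      - b * (norm (Q *v x))\<^sup>2 powr (1 + \<alpha> / 2) \<le> 2 * ((Q *v x) \<bullet> (Q *v (- (H x *\<^sub>R (A *v x)) + G t x)))
      \<and> 2 * ((Q *v x) \<bullet> (Q *v (- (H x *\<^sub>R (A *v x)) + G t x)))
        \<le> - a * (norm (Q *v x))\<^sup>2 powr (1 + \<alpha> / 2)"
proof -
  obtain P D :: "real^'n^'n" where P: "invertible P" and D: "\<And>i j. i \<noteq> j \<Longrightarrow> D $ i $ j = 0"
    and A: "A = P ** D ** matrix_inv P"
    using diag unfolding diagonalizable_def by blast
  define Q where "Q = matrix_inv P"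
  have QP: "Q ** P = mat 1" and PQ: "P ** Q = mat 1"
    unfolding Q_def matrix_inv_def using someI_ex[OF P[unfolded invertible_def]] by blast+
  have D_pos: "D $ i $ i > 0" for i
    using eigen eigenvalue_diagonal[OF QP D] unfolding A Q_def by blast
  have PQx: "P *v (Q *v x) = x" for x using PQ by (simp add: matrix_vector_mul_assoc)
  have QAx: "Q *v (A *v x) = D *v (Q *v x)" for x
    unfolding A Q_def[symmetric] by (simp add: matrix_vector_mul_assoc matrix_mul_assoc QP)
  obtain p where p: "p > 0" "\<And>x. norm (P *v x) \<le> p * norm x"
    using matrix_vector_mult_norm_bound[of P] by blast
  obtain q where q: "q > 0" "\<And>x. norm (Q *v x) \<le> q * norm x"
    using matrix_vector_mult_norm_bound[of Q] by blast
  have px: "norm x \<le> p * norm (Q *v x)" for x using p(2)[of "Q *v x"] by (simp add: PQx)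
  obtain h\<^sub>1 h\<^sub>2 where h: "h\<^sub>1 > 0" "h\<^sub>2 > 0"
    "\<And>x. x \<noteq> 0 \<Longrightarrow> h\<^sub>1 * norm x powr \<alpha> \<le> H x \<and> H x \<le> h\<^sub>2 * norm x powr \<alpha>"
    using pos_homogeneous_bounds[OF H] by blast
  obtain d\<^sub>1 d\<^sub>2 where d: "d\<^sub>1 > 0" "d\<^sub>2 > 0"
    "\<And>w. d\<^sub>1 * (norm w)\<^sup>2 \<le> w \<bullet> (D *v w) \<and> w \<bullet> (D *v w) \<le> d\<^sub>2 * (norm w)\<^sup>2"
    using diagonal_inner_bounds[OF D D_pos] by blast
  \<comment> \<open>With \<open>n = norm (Q *v x)\<close>, the norm of \<open>x\<close> lies between
    \<open>n / q\<close> and \<open>p * n\<close>; these constants restate the bounds on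
    \<open>H\<close> and \<open>G\<close> in powers of \<open>n\<close>.\<close>
  define g\<^sub>1 where "g\<^sub>1 = h\<^sub>1 * (1 / q) powr \<alpha>"
  define g\<^sub>2 where "g\<^sub>2 = h\<^sub>2 * p powr \<alpha>"
  define c' where "c' = q * c * p powr (1 + \<alpha> + \<delta>)"
  define a where "a = g\<^sub>1 * d\<^sub>1"
  \<comment> \<open>Below the first threshold \<open>c' * n powr \<delta>\<close> is at most
    \<open>a / 2\<close>, so \<open>G\<close> uses up only half of the dissipation; below the
    second, \<open>norm x\<close> is at most \<open>r\<close>, so the bound on \<open>G\<close>
    applies.\<close>
  define e where "e = min ((a / (2 * c')) powr (1 / \<delta>)) (r / p)"
  have pos: "g\<^sub>1 > 0" "g\<^sub>2 > 0" "c' > 0" "a > 0"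
    using h d p q \<open>c > 0\<close> by (auto simp: g\<^sub>1_def g\<^sub>2_def c'_def a_def)
  then have "e > 0" using \<open>r > 0\<close> p by (auto simp: e_def)
  have small: "norm (Q *v x) < e" if "(norm (Q *v x))\<^sup>2 < e\<^sup>2" for x
    using that \<open>e > 0\<close> by (simp add: power_less_imp_less_base)
  have r: "norm x \<le> r" if "(norm (Q *v x))\<^sup>2 < e\<^sup>2" for x
  proof -
    have "p * norm (Q *v x) \<le> p * (r / p)"
      using small[OF that] p by (intro mult_left_mono) (auto simp: e_def)
    then show ?thesis using px[of x] p by simp
  qed
  show ?thesis
  proof (rule that[of p q "e\<^sup>2" a Q "2 * g\<^sub>2 * d\<^sub>2 + a"])
    show "norm x \<le> p * norm (Q *v x)" "norm (Q *v x) \<le> q * norm x" for x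
      by (fact px q)+
    fix t x assume t: "t \<ge> t\<^sub>0" and "x \<noteq> 0" and E: "(norm (Q *v x))\<^sup>2 < e\<^sup>2"
    define w where "w = Q *v x"
    define n where "n = norm w"
    define N where "N = n powr \<alpha> * n\<^sup>2"
    have "w \<noteq> 0" using PQx[of x] \<open>x \<noteq> 0\<close> by (auto simp: w_def)
    then have "n > 0" by (simp add: n_def)
    then have "N > 0" by (simp add: N_def)
    have N: "n\<^sup>2 powr (1 + \<alpha> / 2) = N"
      using \<open>n > 0\<close> by (simp add: N_def powr_add powr_powr flip: powr_numeral)
    have xn: "norm x \<le> p * n" "n \<le> q * norm x" using px q by (auto simp: n_def w_def)
    have "g\<^sub>1 * n powr \<alpha> = h\<^sub>1 * (n / q) powr \<alpha>"
      using q \<open>n > 0\<close> by (simp add: g\<^sub>1_def powr_divide)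
    also have "\<dots> \<le> h\<^sub>1 * norm x powr \<alpha>"
      using h xn q \<open>n > 0\<close> \<open>\<alpha> > 0\<close> by (intro mult_left_mono powr_mono2) (auto simp: field_simps)
    also have "\<dots> \<le> H x" using h(3)[OF \<open>x \<noteq> 0\<close>] by simp
    finally have H1: "g\<^sub>1 * n powr \<alpha> \<le> H x" .
    have "H x \<le> h\<^sub>2 * norm x powr \<alpha>" using h(3)[OF \<open>x \<noteq> 0\<close>] by simp
    also have "\<dots> \<le> h\<^sub>2 * (p * n) powr \<alpha>"
      using h xn \<open>\<alpha> > 0\<close> by (intro mult_left_mono powr_mono2) auto
    also have "\<dots> = g\<^sub>2 * n powr \<alpha>" using p \<open>n > 0\<close> by (simp add: g\<^sub>2_def powr_mult)
    finally have H2: "H x \<le> g\<^sub>2 * n powr \<alpha>" .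
    have W: "d\<^sub>1 * n\<^sup>2 \<le> w \<bullet> (D *v w)" "w \<bullet> (D *v w) \<le> d\<^sub>2 * n\<^sup>2" using d by (auto simp: n_def)
    have lower: "a * N \<le> H x * (w \<bullet> (D *v w))"
    proof -
      have "a * N = (g\<^sub>1 * n powr \<alpha>) * (d\<^sub>1 * n\<^sup>2)" by (simp add: a_def N_def)
      also have "\<dots> \<le> H x * (w \<bullet> (D *v w))"
        using H1 W pos d H(3)[OF \<open>x \<noteq> 0\<close>] by (intro mult_mono) auto
      finally show ?thesis .
    qed
    have upper: "H x * (w \<bullet> (D *v w)) \<le> g\<^sub>2 * d\<^sub>2 * N"
    proof -
      have "0 \<le> d\<^sub>1 * n\<^sup>2" using d by simp
      then have "0 \<le> w \<bullet> (D *v w)" using W by linarith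
      then have "H x * (w \<bullet> (D *v w)) \<le> (g\<^sub>2 * n powr \<alpha>) * (d\<^sub>2 * n\<^sup>2)"
        using H2 W pos by (intro mult_mono) auto
      then show ?thesis by (simp add: N_def mult_ac)
    qed
    have pert: "\<bar>w \<bullet> (Q *v G t x)\<bar> \<le> a / 2 * N"
    proof -
      have "\<bar>w \<bullet> (Q *v G t x)\<bar> \<le> n * norm (Q *v G t x)"
        unfolding n_def by (rule Cauchy_Schwarz_ineq2)
      also have "\<dots> \<le> n * (q * norm (G t x))"
        using q \<open>n > 0\<close> by (intro mult_left_mono) auto
      also have "\<dots> \<le> n * (q * (c * norm x powr (1 + \<alpha> + \<delta>)))"
        using q \<open>n > 0\<close> G[OF t r[OF E]] by (intro mult_left_mono) auto
      also have "\<dots> \<le> n * (q * (c * (p * n) powr (1 + \<alpha> + \<delta>)))"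
        using q \<open>n > 0\<close> \<open>c > 0\<close> xn \<open>\<alpha> > 0\<close> \<open>\<delta> > 0\<close> by (intro mult_left_mono powr_mono2) auto
      \<comment> \<open>The total exponent of \<open>n\<close> is 2 + \<alpha> + \<delta>, which
        exceeds that of \<open>N\<close> by \<delta>.\<close>
      also have "\<dots> = c' * n powr \<delta> * N"
        using p \<open>n > 0\<close>
        by (simp add: c'_def N_def powr_mult powr_add power2_eq_square mult_ac)
      also have "\<dots> \<le> a / 2 * N"
      proof -
        have "n powr \<delta> \<le> ((a / (2 * c')) powr (1 / \<delta>)) powr \<delta>"
          using small[OF E] \<open>n > 0\<close> \<open>\<delta> > 0\<close>
          by (intro powr_mono2) (auto simp: n_def w_def e_def)
        also have "\<dots> = a / (2 * c')" using pos \<open>\<delta> > 0\<close> by (simp add: powr_powr)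
        finally have "c' * n powr \<delta> \<le> a / 2" using pos by (simp add: field_simps)
        then show ?thesis using \<open>N > 0\<close> by (intro mult_right_mono) auto
      qed
      finally show ?thesis .
    qed
    \<comment> \<open>After doubling, the diagonal term lies between
      \<open>- 2 * g\<^sub>2 * d\<^sub>2 * N\<close> and \<open>- 2 * a * N\<close>, and the
      perturbation is at most \<open>a * N\<close> in absolute value. This accounts for the rates
      \<open>a\<close> and \<open>2 * g\<^sub>2 * d\<^sub>2 + a\<close>.\<close>
    have "w \<bullet> (Q *v (- (H x *\<^sub>R (A *v x)) + G t x)) = - (H x * (w \<bullet> (D *v w))) + w \<bullet> (Q *v G t x)"
      by (simp add: matrix_vector_mult_diff_distrib matrix_vector_mult_scaleR QAx
          inner_diff_right w_def)
    then show "- (2 * g\<^sub>2 * d\<^sub>2 + a) * (norm (Q *v x))\<^sup>2 powr (1 + \<alpha> / 2)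
        \<le> 2 * ((Q *v x) \<bullet> (Q *v (- (H x *\<^sub>R (A *v x)) + G t x)))
      \<and> 2 * ((Q *v x) \<bullet> (Q *v (- (H x *\<^sub>R (A *v x)) + G t x)))
        \<le> - a * (norm (Q *v x))\<^sup>2 powr (1 + \<alpha> / 2)"
      unfolding w_def[symmetric] n_def[symmetric] N
      using lower upper pert by (auto simp: algebra_simps)
  qed (use p q pos \<open>e > 0\<close> r in auto)
qed

section \<open>Truncation of the field outside a ball\<close>

text \<open>The nearest-point projection onto the ball is 1-Lipschitz, so composing with it makes
  Lipschitz constants on the ball global in \<open>x\<close>. For \<open>G\<close>, one constant for
  all \<open>t\<close> up to \<open>T\<close> comes from the compact product of the time interval
  and the ball.\<close>

lemma truncation_lipschitz:
  fixes F :: "'a::euclidean_space \<Rightarrow> 'a" and G :: "real \<Rightarrow> 'a \<Rightarrow> 'a"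
  assumes "locally_lipschitz F" and "lipschitz_snd_on_compacts {t\<^sub>0..} G" and "r > 0"
  shows "\<exists>L. \<forall>t\<in>{t\<^sub>0..T}. L-lipschitz_on UNIV
    (\<lambda>x. - F (closest_point (cball 0 r) x) + G t (closest_point (cball 0 r) x))"
proof -
  let ?\<pi> = "closest_point (cball (0::'a) r)"
  have in_ball: "?\<pi> x \<in> cball 0 r" for x
    using \<open>r > 0\<close> by (intro closest_point_in_set) auto
  have \<pi>: "1-lipschitz_on UNIV ?\<pi>"
    using \<open>r > 0\<close> closest_point_lipschitz[of "cball (0::'a) r"] by (auto intro!: lipschitz_onI)
  obtain L\<^sub>F where F: "L\<^sub>F-lipschitz_on (cball 0 r) F"
    using locally_lipschitz_imp_lipschitz_on_compact[OF assms(1)] by (metis compact_cball)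
  have "compact ({t\<^sub>0..T} \<times> cball (0::'a) r)" "{t\<^sub>0..T} \<times> cball (0::'a) r \<subseteq> {t\<^sub>0..} \<times> UNIV"
    by (auto intro: compact_Times)
  then obtain L\<^sub>G where
    G: "L\<^sub>G-lipschitz_on {x. (t, x) \<in> {t\<^sub>0..T} \<times> cball (0::'a) r} (G t)" for t
    using assms(2) unfolding lipschitz_snd_on_compacts_def by blast
  have "(L\<^sub>F + L\<^sub>G)-lipschitz_on UNIV (\<lambda>x. - F (?\<pi> x) + G t (?\<pi> x))" if t: "t \<in> {t\<^sub>0..T}" for t
  proof -
    have "L\<^sub>G-lipschitz_on (cball 0 r) (G t)"
      using G[of t] t by (auto elim!: lipschitz_on_subset)
    with F have "(L\<^sub>F + L\<^sub>G)-lipschitz_on (cball 0 r) (\<lambda>x. - F x + G t x)"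
      by (intro lipschitz_on_add) simp_all
    then have "((L\<^sub>F + L\<^sub>G) * 1)-lipschitz_on UNIV ((\<lambda>x. - F x + G t x) \<circ> ?\<pi>)"
      using in_ball by (intro lipschitz_on_compose[OF \<pi>]) (auto elim!: lipschitz_on_subset)
    then show ?thesis by (simp add: o_def)
  qed
  then show ?thesis by blast
qed

section \<open>Existence, uniqueness and decay for the original equation\<close>

theorem theorem3p5:
  fixes A :: "real^'n^'n"
    and H :: "real^'n \<Rightarrow> real"
    and G :: "real \<Rightarrow> real^'n \<Rightarrow> real^'n"
    and \<alpha> t\<^sub>s c\<^sub>s r\<^sub>s \<delta> :: real
  assumes "diagonalizable A"
    and "\<And>\<mu>. eigenvalue A \<mu> \<Longrightarrow> \<mu> > 0"
    and "\<alpha> > 0"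
    and "continuous_on UNIV H"
    and "pos_homogeneous \<alpha> H"
    and "\<And>x. x \<noteq> 0 \<Longrightarrow> H x > 0"
    and "locally_lipschitz (\<lambda>x. H x *\<^sub>R (A *v x))"
    and "t\<^sub>s \<ge> 0"
    and "continuous_on ({t\<^sub>s..} \<times> UNIV) (\<lambda>(t, x). G t x)"
    and "lipschitz_snd_on_compacts {t\<^sub>s..} G"
    and "c\<^sub>s > 0" and "r\<^sub>s > 0" and "\<delta> > 0"
    and "\<And>t x. t \<ge> t\<^sub>s \<Longrightarrow> norm x \<le> r\<^sub>s \<Longrightarrow> norm (G t x) \<le> c\<^sub>s * norm x powr (1 + \<alpha> + \<delta>)"
  shows "\<exists>r\<^sub>0>0. \<forall>y\<^sub>0. 0 < norm y\<^sub>0 \<and> norm y\<^sub>0 < r\<^sub>0 \<longrightarrow>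
    (let sol = ode_solution (\<lambda>t x. - (H x *\<^sub>R (A *v x)) + G t x) t\<^sub>s y\<^sub>0 in
      (\<exists>y. sol y \<and> (\<forall>z. sol z \<longrightarrow> (\<forall>t\<ge>t\<^sub>s. z t = y t))) \<and>
      (\<forall>y. sol y \<longrightarrow>
        (\<exists>C\<^sub>1>0. \<exists>C\<^sub>2>0. \<forall>t\<ge>t\<^sub>s.
          C\<^sub>1 * (1 + t) powr (- 1 / \<alpha>) \<le> norm (y t) \<and>
          norm (y t) \<le> C\<^sub>2 * (1 + t) powr (- 1 / \<alpha>))))"
proof -
  define f where "f = (\<lambda>t x. - (H x *\<^sub>R (A *v x)) + G t x)"
  obtain Q :: "real^'n^'n" and p q E a b where pos: "p > 0" "q > 0" "E > 0" "a > 0"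
    and px: "\<And>x. norm x \<le> p * norm (Q *v x)" and qx: "\<And>x. norm (Q *v x) \<le> q * norm x"
    and rE: "\<And>x. (norm (Q *v x))\<^sup>2 < E \<Longrightarrow> norm x \<le> r\<^sub>s"
    and ineq: "\<And>t x. t \<ge> t\<^sub>s \<Longrightarrow> x \<noteq> 0 \<Longrightarrow> (norm (Q *v x))\<^sup>2 < E \<Longrightarrow>
      - b * (norm (Q *v x))\<^sup>2 powr (1 + \<alpha> / 2) \<le> 2 * ((Q *v x) \<bullet> (Q *v f t x))
      \<and> 2 * ((Q *v x) \<bullet> (Q *v f t x)) \<le> - a * (norm (Q *v x))\<^sup>2 powr (1 + \<alpha> / 2)"
    unfolding f_def
    by (rule lyapunov_bounds[of A \<alpha> H c\<^sub>s r\<^sub>s \<delta> t\<^sub>s G]) (blast intro: assms)+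
  define V where "V = (\<lambda>x. (norm (Q *v x))\<^sup>2)"
  have V_pos: "V x > 0" if "x \<noteq> 0" for x
    using px[of x] that by (auto simp: V_def)
  \<comment> \<open>Stated for every field \<open>F\<close> that agrees with \<open>f\<close> on the
    ball of radius \<open>r\<^sub>s\<close>, to cover both \<open>f\<close> and its truncation. No
    agreement outside is needed, as \<open>V < E\<close> already forces the solution into that
    ball.\<close>
  have decay: "\<forall>t\<ge>t\<^sub>s. 0 < V (z t) \<and> V (z t) < E"
    "\<exists>k>0. \<exists>K>0. \<forall>t\<ge>t\<^sub>s. k * (1 + t) \<le> V (z t) powr (- (\<alpha> / 2)) \<and>
      V (z t) powr (- (\<alpha> / 2)) \<le> K * (1 + t)"
    if sol: "ode_solution F t\<^sub>s y\<^sub>0 z" and F: "\<And>t x. norm x \<le> r\<^sub>s \<Longrightarrow> F t x = f t x"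
      and y0: "y\<^sub>0 \<noteq> 0" "V y\<^sub>0 < E" for F y\<^sub>0 z
  proof -
    have cont: "continuous_on {t\<^sub>s..} (\<lambda>t. V (z t))"
      unfolding V_def
      by (intro continuous_intros ode_solution_continuous_on[OF sol]
          bounded_linear.continuous_on[OF matrix_vector_mul_bounded_linear])
    have deriv: "\<exists>d. ((\<lambda>t. V (z t)) has_real_derivative d) (at t) \<and>
        - b * V (z t) powr (1 + \<alpha> / 2) \<le> d \<and> d \<le> - a * V (z t) powr (1 + \<alpha> / 2)"
      if t: "t > t\<^sub>s" and V: "0 < V (z t)" "V (z t) < E" for t
    proof -
      have "F t (z t) = f t (z t)" using F rE V by (simp add: V_def)
      then have "(z has_vector_derivative f t (z t)) (at t)"
        using sol t by (auto simp: ode_solution_def)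
      then have "((\<lambda>t. Q *v z t) has_vector_derivative Q *v f t (z t)) (at t)"
        by (rule bounded_linear.has_vector_derivative[OF matrix_vector_mul_bounded_linear])
      from has_real_derivative_inner_self[OF this]
      have "((\<lambda>t. V (z t)) has_real_derivative 2 * ((Q *v z t) \<bullet> (Q *v f t (z t)))) (at t)"
        by (simp add: V_def power2_norm_eq_inner)
      moreover have "z t \<noteq> 0" using V by (auto simp: V_def)
      ultimately show ?thesis using ineq[of t "z t"] t V unfolding V_def by auto
    qed
    have "z t\<^sub>s = y\<^sub>0" using sol by (simp add: ode_solution_def)
    then have init: "0 < V (z t\<^sub>s)" "V (z t\<^sub>s) < E" using y0 V_pos by auto
    have "\<alpha> / 2 > 0" using \<open>\<alpha> > 0\<close> by simp
    note * = powr_decay[OF cont init \<open>t\<^sub>s \<ge> 0\<close> this \<open>a > 0\<close> deriv]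
    show "\<forall>t\<ge>t\<^sub>s. 0 < V (z t) \<and> V (z t) < E" by (rule *(1))
    show "\<exists>k>0. \<exists>K>0. \<forall>t\<ge>t\<^sub>s. k * (1 + t) \<le> V (z t) powr (- (\<alpha> / 2)) \<and>
      V (z t) powr (- (\<alpha> / 2)) \<le> K * (1 + t)" by (rule *(2))
  qed
  have bounds: "\<exists>C\<^sub>1>0. \<exists>C\<^sub>2>0. \<forall>t\<ge>t\<^sub>s. C\<^sub>1 * (1 + t) powr (- 1 / \<alpha>) \<le> norm (z t) \<and>
      norm (z t) \<le> C\<^sub>2 * (1 + t) powr (- 1 / \<alpha>)"
    if sol: "ode_solution f t\<^sub>s y\<^sub>0 z" and y0: "y\<^sub>0 \<noteq> 0" "V y\<^sub>0 < E" for y\<^sub>0 z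
  proof -
    obtain k K where kK: "k > 0" "K > 0" "\<And>t. t \<ge> t\<^sub>s \<Longrightarrow> k * (1 + t) \<le> V (z t) powr (- (\<alpha> / 2)) \<and>
      V (z t) powr (- (\<alpha> / 2)) \<le> K * (1 + t)"
      using decay(2)[OF sol _ y0] by blast
    \<comment> \<open>The linear bounds on \<open>n powr (- \<alpha>)\<close> are raised to the
      negative power -1/\<alpha>, which reverses them: \<open>K\<close> gives the lower bound and
      \<open>k\<close> the upper one. The factors \<open>q\<close> and \<open>p\<close> return from
      \<open>n\<close> to the norm of \<open>z t\<close>.\<close>
    have "K powr (- 1 / \<alpha>) / q * (1 + t) powr (- 1 / \<alpha>) \<le> norm (z t) \<and>
      norm (z t) \<le> p * k powr (- 1 / \<alpha>) * (1 + t) powr (- 1 / \<alpha>)" if t: "t \<ge> t\<^sub>s" for t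
    proof -
      define n where "n = norm (Q *v z t)"
      have "V (z t) > 0" using decay(1)[OF sol _ y0] t by blast
      then have "n > 0" by (simp add: V_def n_def)
      have "t \<ge> 0" using t \<open>t\<^sub>s \<ge> 0\<close> by simp
      have "V (z t) powr (- (\<alpha> / 2)) = n powr (- \<alpha>)"
        using \<open>n > 0\<close> by (simp add: V_def n_def powr_powr flip: powr_numeral)
      then have U: "k * (1 + t) \<le> n powr (- \<alpha>)" "n powr (- \<alpha>) \<le> K * (1 + t)"
        using kK(3)[OF t] by auto
      have n: "(n powr (- \<alpha>)) powr (- 1 / \<alpha>) = n" using \<open>n > 0\<close> \<open>\<alpha> > 0\<close> by (simp add: powr_powr)
      have "(K * (1 + t)) powr (- 1 / \<alpha>) \<le> n"
        using U \<open>n > 0\<close> \<open>\<alpha> > 0\<close> by (subst n[symmetric], intro powr_mono2') auto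
      also have "n \<le> q * norm (z t)" by (simp add: n_def qx)
      finally have lower: "K powr (- 1 / \<alpha>) / q * (1 + t) powr (- 1 / \<alpha>) \<le> norm (z t)"
        using pos by (simp only: powr_mult) (simp add: divide_simps mult_ac)
      have "n \<le> (k * (1 + t)) powr (- 1 / \<alpha>)"
        using U kK \<open>t \<ge> 0\<close> \<open>\<alpha> > 0\<close> by (subst n[symmetric], intro powr_mono2') auto
      then have "p * n \<le> p * (k * (1 + t)) powr (- 1 / \<alpha>)" using pos by (intro mult_left_mono) auto
      then have "norm (z t) \<le> p * k powr (- 1 / \<alpha>) * (1 + t) powr (- 1 / \<alpha>)"
        using px[of "z t"] kK \<open>t \<ge> 0\<close> by (simp add: n_def powr_mult)
      with lower show ?thesis by blast
    qed
    moreover have "K powr (- 1 / \<alpha>) / q > 0" "p * k powr (- 1 / \<alpha>) > 0" using pos kK by auto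
    ultimately show ?thesis by blast
  qed
  define \<pi> where "\<pi> = closest_point (cball (0 :: real^'n) r\<^sub>s)"
  define g where "g = (\<lambda>t x. f t (\<pi> x))"
  have g_eq: "g t x = f t x" if "norm x \<le> r\<^sub>s" for t x
    using that by (simp add: g_def \<pi>_def closest_point_self)
  have lip: "\<exists>L. \<forall>t\<in>{t\<^sub>s..T}. L-lipschitz_on UNIV (g t)" for T
    using truncation_lipschitz[OF assms(7,10) \<open>r\<^sub>s > 0\<close>] unfolding g_def f_def \<pi>_def by blast
  have cont: "continuous_on ({t\<^sub>s..} \<times> UNIV) (\<lambda>(t, x). g t x)"
  proof -
    have \<pi>: "continuous_on S \<pi>" for S
      unfolding \<pi>_def using \<open>r\<^sub>s > 0\<close> by (intro continuous_on_closest_point) auto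
    have \<pi>_snd: "continuous_on ({t\<^sub>s..} \<times> UNIV) (\<lambda>(t, x). \<pi> x)"
      unfolding case_prod_unfold
      by (rule continuous_on_compose2[OF \<pi>[of UNIV]]) (auto intro!: continuous_intros)
    have "continuous_on ({t\<^sub>s..} \<times> UNIV) (\<lambda>u. H (\<pi> (snd u)))"
      by (rule continuous_on_compose2[OF assms(4)])
        (use \<pi>_snd in \<open>auto simp: case_prod_unfold\<close>)
    moreover have "continuous_on ({t\<^sub>s..} \<times> UNIV) (\<lambda>u. A *v \<pi> (snd u))"
      by (rule bounded_linear.continuous_on[OF matrix_vector_mul_bounded_linear])
        (use \<pi>_snd in \<open>auto simp: case_prod_unfold\<close>)
    moreover have "continuous_on ({t\<^sub>s..} \<times> UNIV) (\<lambda>u. (\<lambda>(t, x). G t x) (fst u, \<pi> (snd u)))"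
      by (rule continuous_on_compose2[OF assms(9)])
        (use \<pi>_snd in \<open>auto simp: case_prod_unfold intro!: continuous_intros\<close>)
    ultimately show ?thesis
      unfolding g_def f_def case_prod_unfold by (auto intro!: continuous_intros)
  qed
  \<comment> \<open>Used in both directions: a solution of the truncated equation solves the
    original one, which gives existence, and conversely, which gives uniqueness.\<close>
  have transfer: "ode_solution F' t\<^sub>s y\<^sub>0 z"
    if sol: "ode_solution F t\<^sub>s y\<^sub>0 z" and y0: "y\<^sub>0 \<noteq> 0" "V y\<^sub>0 < E"
      and F: "\<And>t x. norm x \<le> r\<^sub>s \<Longrightarrow> F t x = f t x" and F': "\<And>t x. norm x \<le> r\<^sub>s \<Longrightarrow> F' t x = f t x"
    for F F' y\<^sub>0 z
  proof -
    have "norm (z t) \<le> r\<^sub>s" if "t > t\<^sub>s" for t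
      using decay(1)[OF sol F y0] rE that by (simp add: V_def)
    then have "F t (z t) = F' t (z t)" if "t > t\<^sub>s" for t using F F' that by simp
    then show ?thesis using sol by (simp add: ode_solution_def)
  qed
  \<comment> \<open>The radius ensures that \<open>norm (Q *v y\<^sub>0)\<close> is below
    \<open>sqrt E\<close>, that is, \<open>V y\<^sub>0 < E\<close>.\<close>
  show ?thesis
  proof (rule exI[of _ "sqrt E / q"], intro conjI allI impI)
    show "sqrt E / q > 0" using pos by simp
    fix y\<^sub>0 :: "real^'n" assume y0: "0 < norm y\<^sub>0 \<and> norm y\<^sub>0 < sqrt E / q"
    then have "q * norm y\<^sub>0 < sqrt E" using pos by (simp add: field_simps)
    then have "norm (Q *v y\<^sub>0) < sqrt E" using qx[of y\<^sub>0] by linarith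
    then have "V y\<^sub>0 < (sqrt E)\<^sup>2" unfolding V_def by (intro power_strict_mono) auto
    then have V0: "V y\<^sub>0 < E" "y\<^sub>0 \<noteq> 0" using pos y0 by auto
    obtain y where y: "ode_solution g t\<^sub>s y\<^sub>0 y" using ode_solution_exists[OF cont lip] by blast
    have "ode_solution f t\<^sub>s y\<^sub>0 y" using transfer[OF y V0(2,1) g_eq] by blast
    moreover have "z t = y t" if "ode_solution f t\<^sub>s y\<^sub>0 z" "t \<ge> t\<^sub>s" for z t
      using ode_solution_unique[OF lip y transfer[OF that(1) V0(2,1) refl g_eq] that(2)] .
    ultimately show "let sol = ode_solution (\<lambda>t x. - (H x *\<^sub>R (A *v x)) + G t x) t\<^sub>s y\<^sub>0 in
      (\<exists>y. sol y \<and> (\<forall>z. sol z \<longrightarrow> (\<forall>t\<ge>t\<^sub>s. z t = y t))) \<and>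
      (\<forall>y. sol y \<longrightarrow>
        (\<exists>C\<^sub>1>0. \<exists>C\<^sub>2>0. \<forall>t\<ge>t\<^sub>s.
          C\<^sub>1 * (1 + t) powr (- 1 / \<alpha>) \<le> norm (y t) \<and>
          norm (y t) \<le> C\<^sub>2 * (1 + t) powr (- 1 / \<alpha>)))"
      using bounds[OF _ V0(2,1)] unfolding Let_def f_def[symmetric] by blast
  qed
qed

end
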